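(* Consider a decision tree with $p$ leaves over a feature vector $\bm{w}\in\mathbb{R}^d$, where leaf $l\in[p]$ has finite lower bounds $b_{li}$ and upper bounds $u_{li}$, $b_{li}\le u_{li}$, for $i\in[d]$, and score $s_l\in\mathbb{R}$. Let $$Q^{ext}=\Big\{(\bm{w},y,\bar{\bm{w}},\bar{\bm{y}},\bm{z}) : u_{li}z_l\ge \bar w_{li},\ b_{li}z_l\le \bar w_{li}\ \ \forall i\in[d],\,l\in[p];\ \ \bar y_l=s_lz_l,\ z_l\in[0,1]\ \ \forall l\in[p];$$ $$\sum_{l=1}^p z_l=1;\ \ w_i=\sum_{l=1}^p\bar w_{li}\ \ \forall i\in[d];\ \ y=\sum_{l=1}^p\bar y_l\Big\}\subseteq \mathbb{R}^d\times\mathbb{R}\times\mathbb{R}^{p\times d}\times\mathbb{R}^p\times\mathbb{R}^p$$ and $$Q^{proj}=\Big\{(\bm{w},y,\bm{z})\in\mathbb{R}^d\times\mathbb{R}\times\mathbb{R}^p : \sum_{l=1}^p u_{li}z_l\ge w_i,\ \sum_{l=1}^p b_{li}z_l\le w_i\ \ \forall i\in[d];\ \ y=\sum_{l=1}^p s_lz_l;\ \ \sum_{l=1}^p z_l=1;\ \ z_l\in[0,1]\ \ \forall l\in[p]\Big\}.$$ Then $\mathrm{Proj}_{\bm{w},y,\bm{z}}(Q^{ext})=Q^{proj}$. Furthermore, $Q^{proj}$ is ideal, i.e. every extreme point $(\bm{w},y,\bm{z})$ of $Q^{proj}$ satisfies $\bm{z}\in\{0,1\}^p$.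
   Context: Notation: $[n]=\{1,\dots,n\}$. A decision tree with $p$ leaves is a piecewise constant function of a feature vector $\bm{w}$ ranging over a bounded domain in $\mathbb{R}^d$; it is obtained from a hierarchy of axis-aligned splits. Leaf $l$ corresponds to the set $\mathcal{L}_l=\{(\bm{w},y): b_{li}\le w_i\le u_{li}\ \forall i\in[d],\ y=s_l\}$, a hyperrectangle in the feature space with the constant predicted value $s_l$. $\mathrm{Proj}_{\bm{w},y,\bm{z}}(Q)$ denotes the orthogonal projection, i.e. the set of $(\bm{w},y,\bm{z})$ for which there exist values of the remaining variables such that the full vector lies in $Q$. A mixed-integer formulation given by a polyhedron $Q$ (its linear relaxation) together with the requirement that certain variables $\bm{z}$ be binary is called ideal if at every extreme point of $Q$ those variables take values in $\{0,1\}$. Here the variables required to be binary are $\bm{z}\in\{0,1\}^p$. *)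

theory Defs
  imports "HOL-Analysis.Analysis"
begin

text \<open>
  Features are indexed by \<open>'d\<close> and leaves by \<open>'p\<close>. The leaf \<open>l\<close> has the score \<open>s $ l\<close>,
  kept in a separate vector, and the bounds \<open>b $ l $ i\<close>, \<open>u $ l $ i\<close>.
\<close>

datatype ('d, 'p) dtree =
    Leaf 'p
  | Split 'd real "('d, 'p) dtree" "('d, 'p) dtree"

primrec leaves :: "('d, 'p) dtree \<Rightarrow> 'p list" where
  "leaves (Leaf l) = [l]"
| "leaves (Split i c L R) = leaves L @ leaves R"

primrec leaf_of :: "('d::finite, 'p) dtree \<Rightarrow> real^'d \<Rightarrow> 'p" where
  "leaf_of (Leaf l) w = l"
| "leaf_of (Split i c L R) w = (if w $ i \<le> c then leaf_of L w else leaf_of R w)"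

definition predict :: "('d::finite, 'p::finite) dtree \<Rightarrow> real^'p \<Rightarrow> real^'d \<Rightarrow> real" where
  "predict T s w = s $ leaf_of T w"

text \<open>
  The region cut out by the splits on the way to leaf \<open>l\<close>. Both sides of a split are closed,
  because the hyperrectangles of the leaves are closed and may share a face.
\<close>

primrec closed_cell :: "('d::finite, 'p) dtree \<Rightarrow> 'p \<Rightarrow> (real^'d) set" where
  "closed_cell (Leaf k) l = (if k = l then UNIV else {})"
| "closed_cell (Split i c L R) l =
     ({w. w $ i \<le> c} \<inter> closed_cell L l) \<union> ({w. w $ i \<ge> c} \<inter> closed_cell R l)"

definition leaf_set ::
  "real^'d^'p \<Rightarrow> real^'d^'p \<Rightarrow> real^'p \<Rightarrow> 'p \<Rightarrow> ((real^'d) \<times> real) set" where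
  "leaf_set b u s l = {(w, y). (\<forall>i. b $ l $ i \<le> w $ i \<and> w $ i \<le> u $ l $ i) \<and> y = s $ l}"

text \<open>
  \<open>T\<close> is a decision tree on the domain \<open>D\<close> whose leaves, each index of \<open>'p\<close> occurring exactly
  once, are described by \<open>b\<close>, \<open>u\<close>, \<open>s\<close>. The hyperrectangle of a leaf lies between the points of
  \<open>D\<close> that reach the leaf and the closed cell of the leaf. It need not equal either of them, so
  that \<open>D\<close> can be any bounded set, not just a box.
\<close>

definition is_decision_tree ::
  "(real^'d) set \<Rightarrow> ('d::finite, 'p::finite) dtree \<Rightarrow>
   real^'d^'p \<Rightarrow> real^'d^'p \<Rightarrow> real^'p \<Rightarrow> bool" where
  "is_decision_tree D T b u s \<longleftrightarrow>
     bounded D \<and> distinct (leaves T) \<and> set (leaves T) = UNIV \<and>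
     (\<forall>w\<in>D. (w, predict T s w) \<in> leaf_set b u s (leaf_of T w)) \<and>
     (\<forall>l. fst ` leaf_set b u s l \<subseteq> closed_cell T l)"

definition Q_ext ::
  "real^'d^'p \<Rightarrow> real^'d^'p \<Rightarrow> real^'p \<Rightarrow>
   ((real^'d) \<times> real \<times> (real^'d^'p) \<times> (real^'p) \<times> (real^'p)) set" where
  "Q_ext b u s = {(w, y, wb, yb, z).
     (\<forall>i l. u $ l $ i * z $ l \<ge> wb $ l $ i \<and> b $ l $ i * z $ l \<le> wb $ l $ i) \<and>
     (\<forall>l. yb $ l = s $ l * z $ l \<and> z $ l \<in> {0..1}) \<and>
     (\<Sum>l\<in>UNIV. z $ l) = 1 \<and>
     (\<forall>i. w $ i = (\<Sum>l\<in>UNIV. wb $ l $ i)) \<and>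
     y = (\<Sum>l\<in>UNIV. yb $ l)}"

definition Q_proj ::
  "real^'d^'p \<Rightarrow> real^'d^'p \<Rightarrow> real^'p \<Rightarrow>
   ((real^'d) \<times> real \<times> (real^'p)) set" where
  "Q_proj b u s = {(w, y, z).
     (\<forall>i. (\<Sum>l\<in>UNIV. u $ l $ i * z $ l) \<ge> w $ i \<and> (\<Sum>l\<in>UNIV. b $ l $ i * z $ l) \<le> w $ i) \<and>
     y = (\<Sum>l\<in>UNIV. s $ l * z $ l) \<and>
     (\<Sum>l\<in>UNIV. z $ l) = 1 \<and>
     (\<forall>l. z $ l \<in> {0..1})}"

definition Proj_wyz :: "('w \<times> 'y \<times> 'wb \<times> 'yb \<times> 'z) set \<Rightarrow> ('w \<times> 'y \<times> 'z) set" where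
  "Proj_wyz Q = {(w, y, z). \<exists>wb yb. (w, y, wb, yb, z) \<in> Q}"

text \<open>
  The function \<open>\<zeta>\<close> selects the variables that are required to be binary.
\<close>

definition ideal_formulation :: "('v::real_vector \<Rightarrow> real^'p) \<Rightarrow> 'v set \<Rightarrow> bool" where
  "ideal_formulation \<zeta> Q \<longleftrightarrow> (\<forall>x. x extreme_point_of Q \<longrightarrow> (\<forall>l. \<zeta> x $ l \<in> {0, 1}))"

end

theory Submission
  imports Defs
begin

text \<open>
  Both claims rest on one observation. If \<open>(w, y, z)\<close> lies in the projected polyhedron, then \<open>z\<close>
  is a probability vector and each \<open>w\<^sub>i\<close> lies between the \<open>z\<close>-averages of the lower and of the upper
  bounds. Moving every leaf the same fraction \<open>t\<^sub>i\<close> of the way from its lower to its upper bound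
  realizes \<open>w\<^sub>i\<close>; hence there is one point \<open>c\<^sub>l\<close> in each box with \<open>w = \<Sum>\<^sub>l z\<^sub>l c\<^sub>l\<close>
  (\<open>Q_proj_mixture_of_box_points\<close>).

  The choice \<open>wb\<^sub>l = z\<^sub>l c\<^sub>l\<close> lifts \<open>(w, y, z)\<close> to the extended formulation, which gives the
  difficult inclusion of the projection. On the other hand \<open>(w, y, z)\<close> is the convex combination
  with weights \<open>z\<^sub>l\<close> of the points \<open>(c\<^sub>l, s\<^sub>l, e\<^sub>l)\<close>, where \<open>e\<^sub>l\<close> is the unit vector of
  leaf \<open>l\<close>, and each of them belongs to the projected polyhedron. An extreme point must
  coincide with one of the points of such a combination, so its \<open>z\<close> is a unit vector.
\<close>

text \<open>
  Interpolation commutes with sums, so a parameter that is right for the two totals can be used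
  in every summand.
\<close>

lemma sum_between_imp_common_interpolation:
  fixes f g :: "'a \<Rightarrow> real"
  assumes "sum f A \<le> x" "x \<le> sum g A"
  shows "\<exists>t. 0 \<le> t \<and> t \<le> 1 \<and> x = (\<Sum>a\<in>A. (1 - t) * f a + t * g a)"
proof -
  have "x \<in> closed_segment (sum f A) (sum g A)"
    using assms by (simp add: closed_segment_eq_real_ivl)
  then obtain t where t: "0 \<le> t" "t \<le> 1" "x = (1 - t) * sum f A + t * sum g A"
    by (auto simp: closed_segment_def)
  then show ?thesis
    by (intro exI[of _ t]) (simp add: sum.distrib sum_distrib_left)
qed

text \<open>
  The point of the box is given by the interpolation parameter of each coordinate, common to all
  leaves, so that no division by a weight \<open>z\<^sub>l\<close>, which may be zero, is needed.
\<close>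

lemma Q_proj_mixture_of_box_points:
  fixes b u :: "real^'d::finite^'p::finite"
  assumes le: "\<forall>l i. b $ l $ i \<le> u $ l $ i" and Q: "(w, y, z) \<in> Q_proj b u s"
  obtains c :: "real^'d^'p"
  where "\<And>l i. b $ l $ i \<le> c $ l $ i" "\<And>l i. c $ l $ i \<le> u $ l $ i"
    "w = (\<Sum>l\<in>UNIV. z $ l *\<^sub>R c $ l)"
proof -
  have "\<exists>t. 0 \<le> t \<and> t \<le> 1 \<and>
      w $ i = (\<Sum>l\<in>UNIV. (1 - t) * (b $ l $ i * z $ l) + t * (u $ l $ i * z $ l))" for i
    using Q by (intro sum_between_imp_common_interpolation) (simp_all add: Q_proj_def)
  then have "\<exists>t. \<forall>i. 0 \<le> t i \<and> t i \<le> 1 \<and>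
      w $ i = (\<Sum>l\<in>UNIV. (1 - t i) * (b $ l $ i * z $ l) + t i * (u $ l $ i * z $ l))"
    by (intro choice allI)
  then obtain t where t: "\<And>i. 0 \<le> t i" "\<And>i. t i \<le> 1"
    "\<And>i. w $ i = (\<Sum>l\<in>UNIV. (1 - t i) * (b $ l $ i * z $ l) + t i * (u $ l $ i * z $ l))"
    by blast
  define c :: "real^'d^'p" where "c = (\<chi> l i. b $ l $ i + t i * (u $ l $ i - b $ l $ i))"
  show thesis
  proof (rule that[of c])
    fix l i
    show "b $ l $ i \<le> c $ l $ i"
      using le t(1) by (simp add: c_def)
    show "c $ l $ i \<le> u $ l $ i"
      using le t(2)[of i] mult_right_mono[of "t i" 1 "u $ l $ i - b $ l $ i"] by (simp add: c_def)
  next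
    show "w = (\<Sum>l\<in>UNIV. z $ l *\<^sub>R c $ l)"
      by (simp add: vec_eq_iff t(3) c_def algebra_simps)
  qed
qed

lemma Proj_Q_ext_subset_Q_proj: "Proj_wyz (Q_ext b u s) \<subseteq> Q_proj b u s"
  by (auto simp: Proj_wyz_def Q_ext_def Q_proj_def intro!: sum_mono)

lemma Q_proj_subset_Proj_Q_ext:
  fixes b u :: "real^'d::finite^'p::finite"
  assumes le: "\<forall>l i. b $ l $ i \<le> u $ l $ i"
  shows "Q_proj b u s \<subseteq> Proj_wyz (Q_ext b u s)"
proof clarify
  fix w y z assume Q: "(w, y, z) \<in> Q_proj b u s"
  obtain c :: "real^'d^'p" where c: "\<And>l i. b $ l $ i \<le> c $ l $ i" "\<And>l i. c $ l $ i \<le> u $ l $ i"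
      "w = (\<Sum>l\<in>UNIV. z $ l *\<^sub>R c $ l)"
    by (rule Q_proj_mixture_of_box_points[OF le Q]) blast
  have "(w, y, (\<chi> l. z $ l *\<^sub>R c $ l), (\<chi> l. s $ l * z $ l), z) \<in> Q_ext b u s"
    using Q c(1,2) by (auto simp: Q_ext_def Q_proj_def c(3) mult.commute mult_left_mono)
  then show "(w, y, z) \<in> Proj_wyz (Q_ext b u s)"
    by (auto simp: Proj_wyz_def)
qed

lemma convex_Q_proj: "convex (Q_proj b u s)"
proof -
  \<comment> \<open>The defining constraints as preimages of convex sets under linear maps.\<close>
  have eq: "Q_proj b u s =
      (\<Inter>i. (\<lambda>(w, y, z). (\<Sum>l\<in>UNIV. u $ l $ i * z $ l) - w $ i) -` {0..}) \<inter>
      (\<Inter>i. (\<lambda>(w, y, z). w $ i - (\<Sum>l\<in>UNIV. b $ l $ i * z $ l)) -` {0..}) \<inter>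
      (\<lambda>(w, y, z). y - (\<Sum>l\<in>UNIV. s $ l * z $ l)) -` {0} \<inter>
      (\<lambda>(w, y, z). \<Sum>l\<in>UNIV. z $ l) -` {1} \<inter>
      (\<Inter>l. (\<lambda>(w, y, z). z $ l) -` {0..1})"
    by (auto simp: Q_proj_def)
  show ?thesis
    unfolding eq
    by (intro convex_Int convex_INT convex_linear_vimage linearI)
       (auto simp: algebra_simps sum.distrib sum_distrib_left)
qed

lemma axis_in_Q_proj:
  fixes b u c :: "real^'d::finite^'p::finite"
  assumes "\<And>i. b $ l $ i \<le> c $ l $ i" "\<And>i. c $ l $ i \<le> u $ l $ i"
  shows "(c $ l, s $ l, axis l 1) \<in> Q_proj b u s"
proof -
  have "(\<Sum>k\<in>UNIV. f k * axis l 1 $ k) = f l" for f :: "'p \<Rightarrow> real"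
    by (simp add: axis_def if_distrib cong: if_cong)
  from this this[of "\<lambda>_. 1"] show ?thesis
    using assms by (auto simp: Q_proj_def axis_def)
qed

text \<open>
  Deleting an extreme point leaves a convex set, which still contains every convex combination
  of the remaining points.
\<close>

lemma extreme_point_of_convex_combination:
  assumes "x extreme_point_of S" "convex S" "finite A" "\<And>a. a \<in> A \<Longrightarrow> v a \<in> S"
    and "\<And>a. a \<in> A \<Longrightarrow> 0 \<le> r a" "sum r A = 1" "x = (\<Sum>a\<in>A. r a *\<^sub>R v a)"
  obtains a where "a \<in> A" "x = v a"
proof (rule ccontr)
  assume "\<not> thesis"
  then have "v a \<in> S - {x}" if "a \<in> A" for a
    using assms(4) that \<open>\<And>a. a \<in> A \<Longrightarrow> x = v a \<Longrightarrow> thesis\<close> by blast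
  moreover have "convex (S - {x})"
    using assms(1,2) by (simp add: extreme_point_of_stillconvex)
  ultimately have "(\<Sum>a\<in>A. r a *\<^sub>R v a) \<in> S - {x}"
    using assms(3,5,6) by (intro convex_sum) auto
  then show False
    using assms(7) by simp
qed

lemma ideal_Q_proj:
  fixes b u :: "real^'d::finite^'p::finite"
  assumes le: "\<forall>l i. b $ l $ i \<le> u $ l $ i"
  shows "ideal_formulation (\<lambda>(w, y, z). z) (Q_proj b u s)"
  unfolding ideal_formulation_def
proof (intro allI impI)
  fix x k assume ext: "x extreme_point_of Q_proj b u s"
  obtain w y z where x: "x = (w, y, z)"
    by (cases x)
  have Q: "(w, y, z) \<in> Q_proj b u s"
    using ext x by (simp add: extreme_point_of_def)
  then have z: "\<And>l. 0 \<le> z $ l" "(\<Sum>l\<in>UNIV. z $ l) = 1" and y: "y = (\<Sum>l\<in>UNIV. s $ l * z $ l)"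
    by (auto simp: Q_proj_def)
  obtain c :: "real^'d^'p" where c: "\<And>l i. b $ l $ i \<le> c $ l $ i" "\<And>l i. c $ l $ i \<le> u $ l $ i"
      "w = (\<Sum>l\<in>UNIV. z $ l *\<^sub>R c $ l)"
    by (rule Q_proj_mixture_of_box_points[OF le Q]) blast
  define v where "v l = (c $ l, s $ l, axis l (1::real))" for l
  have "z = (\<Sum>l\<in>UNIV. z $ l *\<^sub>R axis l 1)"
    using basis_expansion[of z] by (simp add: scalar_mult_eq_scaleR)
  then have "x = (\<Sum>l\<in>UNIV. z $ l *\<^sub>R v l)"
    by (simp add: x v_def prod_eq_iff fst_sum snd_sum c(3) y mult.commute)
  moreover have "v l \<in> Q_proj b u s" for l
    unfolding v_def using c(1,2) by (rule axis_in_Q_proj)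
  ultimately obtain l where "x = v l"
    using extreme_point_of_convex_combination[OF ext convex_Q_proj finite,
        where A = UNIV and v = v and r = "($) z"] z
    by blast
  then show "(case x of (w, y, z) \<Rightarrow> z) $ k \<in> {0, 1}"
    by (simp add: v_def axis_def)
qed

theorem theorem1:
  fixes D :: "(real^'d::finite) set"
    and T :: "('d::finite, 'p::finite) dtree"
    and b u :: "real^'d^'p"
    and s :: "real^'p"
  assumes "is_decision_tree D T b u s"
    and "\<forall>l i. b $ l $ i \<le> u $ l $ i"
  shows "Proj_wyz (Q_ext b u s) = Q_proj b u s \<and>
         ideal_formulation (\<lambda>(w, y, z). z) (Q_proj b u s)"
  using Proj_Q_ext_subset_Q_proj Q_proj_subset_Proj_Q_ext[OF assms(2)] ideal_Q_proj[OF assms(2)]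
  by (intro conjI subset_antisym)

end
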